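(* Let $(G,\tau)$ be a compact topological group of $\mathcal{L}(X)$ that acts separately continuously on a complex Banach space $X$, and let $K$ be a set in $X$ that is invariant under the action of $G$. Suppose $z$ is an element of $X\setminus K$ that can be separated from $K$ by a continuous polynomial $Q$ which satisfies $|Q(z)|>1$ and, for some $\eta\in(0,1)$, the set $$\{\mathrm{Arg}(Q(\gamma(z)))\in[0,2\pi): |Q(\gamma(z))|\geq\eta,\ \gamma\in G\}$$ is finite. Then there exists a $G$-invariant continuous polynomial $P$ that separates $z$ and $K$. Furthermore, if $Q$ is homogeneous, then $P$ can be chosen to be homogeneous.
   Context: $\mathcal{L}(X)$ is the space of continuous linear maps from $X$ into itself. A topological group of $\mathcal{L}(X)$ is a set $G\subset\mathcal{L}(X)$ that is a group under composition (with identity $Id_X$), endowed with a topology $\tau$, possibly different from the natural topology of $\mathcal{L}(X)$, making it a topological group; it acts on $X$ by $(\gamma,x)\mapsto\gamma(x)$, and the action is separately continuous if the map $G\times X\to X$, $(\gamma,x)\mapsto\gamma(x)$, is separately continuous. Compact groups are Hausdorff. A set $K\subset X$ is invariant under the action of $G$ if $\gamma(K)\subset K$ for every $\gamma\in G$. Polynomials on $X$ are complex-valued. A polynomial $P$ on $X$ is $G$-invariant if $P(\gamma(x))=P(x)$ for all $x\in X$, $\gamma\in G$. A polynomial $P$ separates a point $z$ and a set $K$ (equivalently, $z$ is separated from $K$ by $P$) if $\sup_{w\in K}|P(w)|<|P(z)|$. $\mathrm{Arg}(w)\in[0,2\pi)$ denotes the argument of a complex number $w\neq 0$. *)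

theory Defs
  imports "HOL-Analysis.Analysis" "HOL-Algebra.Group"
begin

class complex_normed_vector = real_normed_vector +
  fixes scaleC :: "complex \<Rightarrow> 'a \<Rightarrow> 'a"  (infixr "*\<^sub>C" 75)
  assumes scaleC_add_right: "a *\<^sub>C (x + y) = a *\<^sub>C x + a *\<^sub>C y"
    and scaleC_add_left: "(a + b) *\<^sub>C x = a *\<^sub>C x + b *\<^sub>C x"
    and scaleC_scaleC: "a *\<^sub>C b *\<^sub>C x = (a * b) *\<^sub>C x"
    and scaleC_of_real: "complex_of_real r *\<^sub>C x = r *\<^sub>R x"
    and norm_scaleC: "norm (a *\<^sub>C x) = cmod a * norm x"

class complex_banach = complex_normed_vector + banach

instantiation complex :: complex_banach
begin

definition scaleC_complex :: "complex \<Rightarrow> complex \<Rightarrow> complex"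
  where "scaleC_complex a x = a * x"

instance
  by standard
    (simp_all add: scaleC_complex_def algebra_simps norm_mult scaleR_conv_of_real)

end

lemma vector_space_scaleC:
  "vector_space (scaleC :: complex \<Rightarrow> 'a::complex_normed_vector \<Rightarrow> 'a)"
proof
  show "1 *\<^sub>C x = x" for x :: 'a
    using scaleC_of_real[of 1 x] by simp
qed (simp_all add: scaleC_add_right scaleC_add_left scaleC_scaleC)

abbreviation clinear :: "('a::complex_normed_vector \<Rightarrow> 'b::complex_normed_vector) \<Rightarrow> bool"
  where "clinear \<equiv> Vector_Spaces.linear scaleC scaleC"

definition continuous_operators :: "('a::complex_normed_vector \<Rightarrow> 'a) set"
  where "continuous_operators = {T. clinear T \<and> continuous_on UNIV T}"


(* A k-tuple of vectors is an extensional function on {..<k}. *)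
definition multilinear_form :: "nat \<Rightarrow> ((nat \<Rightarrow> 'a::complex_normed_vector) \<Rightarrow> complex) \<Rightarrow> bool"
  where "multilinear_form k A \<longleftrightarrow>
    (\<forall>x \<in> {..<k} \<rightarrow>\<^sub>E UNIV. \<forall>i<k. clinear (\<lambda>y. A (x(i := y))))"

definition homogeneous_polynomial :: "nat \<Rightarrow> ('a::complex_normed_vector \<Rightarrow> complex) \<Rightarrow> bool"
  where "homogeneous_polynomial k P \<longleftrightarrow>
    (\<exists>A. multilinear_form k A \<and> P = (\<lambda>x. A (\<lambda>i\<in>{..<k}. x)))"

definition polynomial :: "('a::complex_normed_vector \<Rightarrow> complex) \<Rightarrow> bool"
  where "polynomial P \<longleftrightarrow>
    (\<exists>n p. (\<forall>k\<le>n. homogeneous_polynomial k (p k)) \<and> P = (\<lambda>x. \<Sum>k\<le>n. p k x))"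

definition continuous_polynomial :: "('a::complex_normed_vector \<Rightarrow> complex) \<Rightarrow> bool"
  where "continuous_polynomial P \<longleftrightarrow> polynomial P \<and> continuous_on UNIV P"

definition homogeneous :: "('a::complex_normed_vector \<Rightarrow> complex) \<Rightarrow> bool"
  where "homogeneous P \<longleftrightarrow> (\<exists>k. homogeneous_polynomial k P)"

(* The supremum is taken in [0, infinity]: it is infinite when P is unbounded on K
   (so P does not separate), and 0 when K is empty. *)
definition separates :: "('a \<Rightarrow> complex) \<Rightarrow> 'a \<Rightarrow> 'a set \<Rightarrow> bool"
  where "separates P z K \<longleftrightarrow> (SUP w\<in>K. ennreal (cmod (P w))) < ennreal (cmod (P z))"


definition topological_group :: "('g, 'm) monoid_scheme \<Rightarrow> 'g topology \<Rightarrow> bool"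
  where "topological_group H \<tau> \<longleftrightarrow>
    group H \<and> topspace \<tau> = carrier H \<and>
    continuous_map (prod_topology \<tau> \<tau>) \<tau> (\<lambda>(x, y). x \<otimes>\<^bsub>H\<^esub> y) \<and>
    continuous_map \<tau> \<tau> (\<lambda>x. inv\<^bsub>H\<^esub> x)"

definition composition_monoid :: "('a \<Rightarrow> 'a) set \<Rightarrow> ('a \<Rightarrow> 'a) monoid"
  where "composition_monoid G = \<lparr>carrier = G, monoid.mult = (\<circ>), one = id\<rparr>"

(* The topology \<tau> on G is arbitrary; it is not assumed to be related to the operator norm. *)
definition compact_operator_group ::
    "('a::complex_normed_vector \<Rightarrow> 'a) set \<Rightarrow> ('a \<Rightarrow> 'a) topology \<Rightarrow> bool"
  where "compact_operator_group G \<tau> \<longleftrightarrow>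
    G \<subseteq> continuous_operators \<and> topological_group (composition_monoid G) \<tau> \<and>
    compact_space \<tau> \<and> Hausdorff_space \<tau>"

definition acts_separately_continuously ::
    "('a::topological_space \<Rightarrow> 'a) set \<Rightarrow> ('a \<Rightarrow> 'a) topology \<Rightarrow> bool"
  where "acts_separately_continuously G \<tau> \<longleftrightarrow>
    (\<forall>x. continuous_map \<tau> euclidean (\<lambda>\<gamma>. \<gamma> x)) \<and> (\<forall>\<gamma>\<in>G. continuous_on UNIV (\<lambda>x. \<gamma> x))"

definition invariant_set :: "('a \<Rightarrow> 'a) set \<Rightarrow> 'a set \<Rightarrow> bool"
  where "invariant_set G K \<longleftrightarrow> (\<forall>\<gamma>\<in>G. \<gamma> ` K \<subseteq> K)"

definition invariant_function :: "('a \<Rightarrow> 'a) set \<Rightarrow> ('a \<Rightarrow> complex) \<Rightarrow> bool"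
  where "invariant_function G P \<longleftrightarrow> (\<forall>x. \<forall>\<gamma>\<in>G. P (\<gamma> x) = P x)"

end

theory Submission
  imports Defs "HOL-Analysis.Kronecker_Approximation_Theorem" "HOL-Library.Function_Algebras"
begin

text \<open>Average a power of \<open>Q\<close> over the group: \<open>P x\<close> is the invariant mean of
  \<open>\<gamma> \<mapsto> Q (\<gamma> x) ^ n\<close>.  On \<open>K\<close> it is bounded by the \<open>n\<close>th power of the supremum of \<open>\<bar>Q\<bar>\<close>.
  At \<open>z\<close>, simultaneous Diophantine approximation of the finitely many arguments gives arbitrarily
  large \<open>n\<close> for which the values \<open>Q (\<gamma> z) ^ n\<close> with \<open>\<bar>Q (\<gamma> z)\<bar> \<ge> \<eta>\<close> have real part at least half
  their modulus, so they do not cancel; since finitely many translates of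
  \<open>{\<gamma>. \<bar>Q (\<gamma> z)\<bar> > r}\<close> cover the group, the real part of \<open>P z\<close> is at least a constant times
  \<open>r ^ n\<close> minus \<open>3 / 2 * \<eta> ^ n\<close>.  Only the mean on continuous functions is needed, and not Haar
  measure: it is obtained from finite averages of translates, following von Neumann.\<close>

section \<open>The invariant mean on a compact group\<close>

text \<open>Lists rather than sets, so that repetitions act as rational weights and neither
  translating nor composing averages requires injectivity. The empty list has average 0.\<close>

definition average :: "'g list \<Rightarrow> ('g \<Rightarrow> real) \<Rightarrow> real"
  where "average L h = (\<Sum>g\<leftarrow>L. h g) / real (length L)"

lemma average_add: "average L (\<lambda>g. h g + k g) = average L h + average L k"
  by (simp add: average_def sum_list_addf add_divide_distrib)

lemma average_cmult: "average L (\<lambda>g. c * h g) = c * average L h"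
  by (simp add: average_def sum_list_const_mult)

lemma average_const: "L \<noteq> [] \<Longrightarrow> average L (\<lambda>g. c) = c"
  by (simp add: average_def sum_list_triv)

lemma average_mono: "(\<And>g. g \<in> set L \<Longrightarrow> h g \<le> k g) \<Longrightarrow> average L h \<le> average L k"
  by (simp add: average_def divide_right_mono sum_list_mono)

lemma average_cong: "(\<And>g. g \<in> set L \<Longrightarrow> h g = k g) \<Longrightarrow> average L h = average L k"
  by (simp add: average_def cong: map_cong)

lemma average_map: "average (map k L) h = average L (\<lambda>g. h (k g))"
  by (simp add: average_def comp_def)

lemma average_swap:
  "average L (\<lambda>g. average M (\<lambda>k. f g k)) = average M (\<lambda>k. average L (\<lambda>g. f g k))"
proof -
  have "(\<Sum>g\<leftarrow>L. \<Sum>k\<leftarrow>M. f g k) = (\<Sum>k\<leftarrow>M. \<Sum>g\<leftarrow>L. f g k)"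
    by (induction L) (simp_all add: sum_list_addf)
  then show ?thesis
    by (simp add: average_def divide_inverse sum_list_mult_const mult.assoc mult.left_commute)
qed

text \<open>All inner lists have the same length, so every entry \<open>p l m\<close> carries the
  same weight in the iterated average.\<close>

lemma average_concat:
  "average L (\<lambda>l. average M (\<lambda>m. h (p l m))) = average (concat (map (\<lambda>l. map (p l) M) L)) h"
proof -
  have "(\<Sum>l\<leftarrow>L. \<Sum>m\<leftarrow>M. h (p l m)) = (\<Sum>g\<leftarrow>concat (map (\<lambda>l. map (p l) M) L). h g)"
    by (induction L) (simp_all add: comp_def)
  moreover have "length (concat (map (\<lambda>l. map (p l) M) L)) = length L * length M"
    by (induction L) simp_all
  ultimately show ?thesis
    by (simp add: average_def divide_inverse sum_list_mult_const)
qed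

lemma average_near:
  assumes "L \<noteq> []" "\<And>g. g \<in> set L \<Longrightarrow> \<bar>h g - c\<bar> \<le> e"
  shows "\<bar>average L h - c\<bar> \<le> e"
proof -
  have "average L h \<le> c + e"
    using average_mono[of L h "\<lambda>_. c + e"] assms average_const[of L "c + e"] by force
  moreover have "c - e \<le> average L h"
    using average_mono[of L "\<lambda>_. c - e" h] assms average_const[of L "c - e"] by force
  ultimately show ?thesis by linarith
qed

lemma average_ge_member:
  assumes "\<And>g. g \<in> set L \<Longrightarrow> 0 \<le> h g" "g \<in> set L"
  shows "h g / real (length L) \<le> average L h"
proof -
  have "(\<Sum>g\<leftarrow>L. h g) = h g + (\<Sum>g\<leftarrow>remove1 g L. h g)"
    using assms(2) by (rule sum_list_map_remove1)
  moreover have "0 \<le> (\<Sum>g\<leftarrow>remove1 g L. h g)"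
    using assms(1) notin_set_remove1 by (intro sum_list_nonneg) fastforce
  ultimately show ?thesis by (simp add: average_def divide_right_mono)
qed

section \<open>One-sided averages over translates on a compact group\<close>

locale compact_group = group H for H (structure) +
  fixes \<tau> :: "'a topology"
  assumes top_group: "topological_group H \<tau>"
    and compact: "compact_space \<tau>"
begin

lemma topspace_eq: "topspace \<tau> = carrier H"
  using top_group by (simp add: topological_group_def)

lemma continuous_map_mult:
  assumes "continuous_map X \<tau> f" "continuous_map X \<tau> g"
  shows "continuous_map X \<tau> (\<lambda>x. f x \<otimes> g x)"
proof -
  have "continuous_map X (prod_topology \<tau> \<tau>) (\<lambda>x. (f x, g x))"
    using assms by (simp add: continuous_map_pairedI)
  from continuous_map_compose[OF this, of \<tau> "\<lambda>(x, y). x \<otimes> y"] show ?thesis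
    using top_group by (simp add: topological_group_def comp_def)
qed

lemma continuous_map_inverse: "continuous_map \<tau> \<tau> (\<lambda>x. inv x)"
  using top_group by (simp add: topological_group_def)

lemma continuous_map_rmult: "g \<in> carrier H \<Longrightarrow> continuous_map \<tau> \<tau> (\<lambda>x. x \<otimes> g)"
  by (intro continuous_map_mult) (simp_all add: topspace_eq)

abbreviation cont :: "('a \<Rightarrow> 'c::topological_space) \<Rightarrow> bool"
  where "cont f \<equiv> continuous_map \<tau> euclidean f"

lemma cont_rmult:
  assumes "cont f" "g \<in> carrier H"
  shows "cont (\<lambda>x. f (x \<otimes> g))"
  using continuous_map_compose[OF continuous_map_rmult[OF assms(2)] assms(1)] by (simp add: comp_def)

lemma cont_inverse: "cont f \<Longrightarrow> cont (\<lambda>x. f (inv x))"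
  using continuous_map_compose[OF continuous_map_inverse] by (fastforce simp: comp_def)

definition group_list :: "'a list \<Rightarrow> bool"
  where "group_list L \<longleftrightarrow> L \<noteq> [] \<and> set L \<subseteq> carrier H"

definition right_average :: "'a list \<Rightarrow> ('a \<Rightarrow> real) \<Rightarrow> 'a \<Rightarrow> real"
  where "right_average L f x = average L (\<lambda>g. f (x \<otimes> g))"

definition left_average :: "'a list \<Rightarrow> ('a \<Rightarrow> real) \<Rightarrow> 'a \<Rightarrow> real"
  where "left_average L f x = average L (\<lambda>g. f (g \<otimes> x))"

text \<open>Equivalently, the constant \<open>c\<close> is a uniform limit of averages, with
  rational weights, of right translates of \<open>f\<close>.\<close>

definition right_mean :: "('a \<Rightarrow> real) \<Rightarrow> real \<Rightarrow> bool"
  where "right_mean f c \<longleftrightarrow>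
    (\<forall>e>0. \<exists>L. group_list L \<and> (\<forall>x\<in>carrier H. \<bar>right_average L f x - c\<bar> \<le> e))"

definition left_mean :: "('a \<Rightarrow> real) \<Rightarrow> real \<Rightarrow> bool"
  where "left_mean f c \<longleftrightarrow>
    (\<forall>e>0. \<exists>L. group_list L \<and> (\<forall>x\<in>carrier H. \<bar>left_average L f x - c\<bar> \<le> e))"

lemma cont_right_average:
  assumes "cont f" "set L \<subseteq> carrier H"
  shows "cont (right_average L f)"
proof -
  have "cont (\<lambda>x. \<Sum>g\<leftarrow>L. f (x \<otimes> g))"
    using assms(2)
    by (induction L) (auto intro!: continuous_map_add cont_rmult assms(1))
  then have "cont (\<lambda>x. inverse (real (length L)) * (\<Sum>g\<leftarrow>L. f (x \<otimes> g)))"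
    by (intro continuous_map_real_mult) auto
  moreover have "right_average L f = (\<lambda>x. inverse (real (length L)) * (\<Sum>g\<leftarrow>L. f (x \<otimes> g)))"
    by (simp add: fun_eq_iff right_average_def average_def divide_inverse)
  ultimately show ?thesis by simp
qed

lemma right_average_comp:
  assumes "group_list L" "group_list M"
  obtains N where "group_list N"
    "\<And>f x. x \<in> carrier H \<Longrightarrow> right_average L (right_average M f) x = right_average N f x"
proof
  let ?N = "concat (map (\<lambda>l. map ((\<otimes>) l) M) L)"
  show "group_list ?N"
    using assms by (cases L; cases M) (auto simp: group_list_def)
  fix f x assume x: "x \<in> carrier H"
  have "right_average L (right_average M f) x = average L (\<lambda>l. average M (\<lambda>m. f (x \<otimes> (l \<otimes> m))))"
    unfolding right_average_def using assms x
    by (intro average_cong) (auto simp: group_list_def m_assoc subset_iff)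
  then show "right_average L (right_average M f) x = right_average ?N f x"
    unfolding right_average_def using average_concat[of L M "\<lambda>g. f (x \<otimes> g)" "(\<otimes>)"] by simp
qed

text \<open>Left and right translations commute by associativity. This is the link between the two
  kinds of mean.\<close>

lemma left_right_average:
  assumes "set L \<subseteq> carrier H" "set M \<subseteq> carrier H" "x \<in> carrier H"
  shows "left_average L (right_average M f) x = right_average M (left_average L f) x"
proof -
  have "left_average L (right_average M f) x = average L (\<lambda>l. average M (\<lambda>m. f (l \<otimes> (x \<otimes> m))))"
    unfolding left_average_def right_average_def using assms
    by (intro average_cong) (auto simp: m_assoc subset_iff)
  then show ?thesis
    unfolding left_average_def right_average_def by (simp add: average_swap[of L M])
qed

lemma right_average_near:
  assumes "group_list L" "\<And>x. x \<in> carrier H \<Longrightarrow> \<bar>f x - c\<bar> \<le> e" "x \<in> carrier H"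
  shows "\<bar>right_average L f x - c\<bar> \<le> e"
  unfolding right_average_def using assms by (intro average_near) (auto simp: group_list_def)

lemma left_average_near:
  assumes "group_list L" "\<And>x. x \<in> carrier H \<Longrightarrow> \<bar>f x - c\<bar> \<le> e" "x \<in> carrier H"
  shows "\<bar>left_average L f x - c\<bar> \<le> e"
  unfolding left_average_def using assms by (intro average_near) (auto simp: group_list_def)

text \<open>Average \<open>f\<close> on both sides. As a left average of a function near
  \<open>d\<close> the result is near \<open>d\<close>; with the order exchanged it is a right
  average of a function near \<open>c\<close>, hence near \<open>c\<close>.\<close>

lemma left_right_mean_unique:
  assumes "left_mean f c" "right_mean f d"
  shows "c = d"
proof -
  have "\<bar>c - d\<bar> \<le> 0 + e" if "e > 0" for e
  proof -
    from that assms obtain L M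
      where L: "group_list L" "\<forall>x\<in>carrier H. \<bar>left_average L f x - c\<bar> \<le> e / 2"
        and M: "group_list M" "\<forall>x\<in>carrier H. \<bar>right_average M f x - d\<bar> \<le> e / 2"
      unfolding left_mean_def right_mean_def by (meson half_gt_zero)
    have "\<bar>left_average L (right_average M f) \<one> - d\<bar> \<le> e / 2"
      using M by (intro left_average_near L) auto
    moreover have "\<bar>right_average M (left_average L f) \<one> - c\<bar> \<le> e / 2"
      using L by (intro right_average_near M) auto
    moreover have "left_average L (right_average M f) \<one> = right_average M (left_average L f) \<one>"
      using L M by (intro left_right_average) (auto simp: group_list_def)
    ultimately show ?thesis by linarith
  qed
  then have "\<bar>c - d\<bar> \<le> 0" by (rule field_le_epsilon)
  then show ?thesis by simp
qed

text \<open>The same list \<open>L\<close> works: after exchanging the averages, \<open>M\<close>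
  averages a function that is already uniformly close to \<open>c\<close>.\<close>

lemma left_mean_right_average:
  assumes "left_mean f c" "group_list M"
  shows "left_mean (right_average M f) c"
  unfolding left_mean_def
proof (intro allI impI)
  fix e :: real assume "e > 0"
  then obtain L where L: "group_list L" "\<forall>x\<in>carrier H. \<bar>left_average L f x - c\<bar> \<le> e"
    using assms(1) unfolding left_mean_def by blast
  have "\<bar>left_average L (right_average M f) x - c\<bar> \<le> e" if x: "x \<in> carrier H" for x
  proof -
    have "left_average L (right_average M f) x = right_average M (left_average L f) x"
      using L(1) assms(2) x by (intro left_right_average) (auto simp: group_list_def)
    then show ?thesis
      using right_average_near[OF assms(2), of "left_average L f" c e x] L(2) x by simp
  qed
  with L show "\<exists>L. group_list L \<and> (\<forall>x\<in>carrier H. \<bar>left_average L (right_average M f) x - c\<bar> \<le> e)"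
    by blast
qed

text \<open>The tube lemma around \<open>{\<one>} \<times> carrier H\<close> makes \<open>U\<close>
  independent of \<open>x\<close>. Since \<open>u\<close> multiplies from the left, the estimate
  holds at every \<open>x \<otimes> g\<close> and so passes to all right averages of
  \<open>f\<close>.\<close>

lemma uniform_neighbourhood:
  fixes f :: "'a \<Rightarrow> real"
  assumes f: "cont f" and e: "e > 0"
  obtains U where "openin \<tau> U" "\<one> \<in> U"
    "\<And>u x. u \<in> U \<Longrightarrow> x \<in> carrier H \<Longrightarrow> \<bar>f (u \<otimes> x) - f x\<bar> < e"
proof -
  let ?W = "{p \<in> topspace (prod_topology \<tau> \<tau>). (f (fst p \<otimes> snd p) - f (snd p)) \<in> ball 0 e}"
  have "continuous_map (prod_topology \<tau> \<tau>) \<tau> (\<lambda>p. fst p \<otimes> snd p)"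
    using continuous_map_mult[OF continuous_map_fst continuous_map_snd] by simp
  from continuous_map_compose[OF this f] continuous_map_compose[OF continuous_map_snd f]
  have "continuous_map (prod_topology \<tau> \<tau>) euclidean (\<lambda>p. f (fst p \<otimes> snd p))"
    and "continuous_map (prod_topology \<tau> \<tau>) euclidean (\<lambda>p. f (snd p))"
    by (simp_all add: comp_def)
  then have "continuous_map (prod_topology \<tau> \<tau>) euclidean
      (\<lambda>p. f (fst p \<otimes> snd p) - f (snd p))"
    by (rule continuous_map_diff)
  then have "openin (prod_topology \<tau> \<tau>) ?W"
    by (rule openin_continuous_map_preimage) (simp flip: open_openin)
  moreover have "compactin \<tau> (carrier H)"
    using compact by (simp add: compact_space_def topspace_eq)
  moreover have "\<one> \<in> topspace \<tau>" "{\<one>} \<times> carrier H \<subseteq> ?W"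
    using e by (auto simp: topspace_eq)
  ultimately obtain U V where UV: "openin \<tau> U" "openin \<tau> V" "\<one> \<in> U" "carrier H \<subseteq> V" "U \<times> V \<subseteq> ?W"
    using tube_lemma_right[of \<tau> \<tau> ?W "carrier H" \<one>] by blast
  have "\<bar>f (u \<otimes> x) - f x\<bar> < e" if "u \<in> U" "x \<in> carrier H" for u x
  proof -
    have "(u, x) \<in> ?W" using that UV by blast
    then show ?thesis by (simp add: dist_real_def abs_minus_commute)
  qed
  with UV that show ?thesis by blast
qed

text \<open>Each \<open>x\<close> is moved into \<open>U\<close> by \<open>g = inv x\<close>, and
  the preimages of \<open>U\<close> under right translations are open, so compactness leaves
  finitely many.\<close>

lemma finite_translates_cover:
  assumes "openin \<tau> U" "\<one> \<in> U"
  obtains C where "group_list C" "\<And>x. x \<in> carrier H \<Longrightarrow> \<exists>c\<in>set C. x \<otimes> c \<in> U"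
proof -
  let ?T = "\<lambda>g. {x \<in> topspace \<tau>. x \<otimes> g \<in> U}"
  have "openin \<tau> (?T g)" if "g \<in> carrier H" for g
    using openin_continuous_map_preimage[OF continuous_map_rmult[OF that] assms(1)] .
  moreover have "topspace \<tau> \<subseteq> \<Union>(?T ` carrier H)"
  proof
    fix x assume "x \<in> topspace \<tau>"
    then have "x \<in> ?T (inv x)" "inv x \<in> carrier H"
      using assms by (auto simp: topspace_eq)
    then show "x \<in> \<Union>(?T ` carrier H)" by blast
  qed
  ultimately obtain F where F: "finite F" "F \<subseteq> ?T ` carrier H" "topspace \<tau> \<subseteq> \<Union>F"
    using compact unfolding compact_space_alt by (metis (no_types, lifting) imageE)
  then obtain D where D: "finite D" "D \<subseteq> carrier H" "F = ?T ` D"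
    by (meson finite_subset_image)
  then obtain C where C: "set C = D" using finite_list by blast
  have cov: "\<exists>c\<in>set C. x \<otimes> c \<in> U" if "x \<in> carrier H" for x
    using that F D C by (auto simp: topspace_eq)
  have "C \<noteq> []" using cov[of \<one>] by auto
  with C D cov that show ?thesis by (auto simp: group_list_def)
qed

lemma cont_bounded:
  fixes f :: "'a \<Rightarrow> 'c::real_normed_vector"
  assumes "cont f"
  obtains B where "\<And>x. x \<in> carrier H \<Longrightarrow> norm (f x) \<le> B"
proof -
  have "compactin euclidean (f ` topspace \<tau>)"
    using compact assms by (intro image_compactin) (simp_all add: compact_space_def)
  then have "bounded (f ` carrier H)"
    by (simp add: compact_imp_bounded topspace_eq)
  with that show ?thesis unfolding bounded_iff by auto
qed

text \<open>The mean is the infimum \<open>s\<close> of the upper bounds of the averages of \<open>f\<close>.  All averages of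
  \<open>f\<close> share a modulus of continuity, so an average which is well below \<open>s\<close> somewhere is so on a
  translate of a fixed neighbourhood; averaging once more over finitely many translates covering
  the group would then push the upper bound below \<open>s\<close>.\<close>

lemma right_mean_exists:
  assumes f: "cont f"
  shows "\<exists>c. right_mean f c"
proof -
  define T where "T = {t. \<exists>L. group_list L \<and> (\<forall>x\<in>carrier H. right_average L f x \<le> t)}"
  define s where "s = Inf T"
  obtain B where B: "\<And>x. x \<in> carrier H \<Longrightarrow> \<bar>f x\<bar> \<le> B"
    using cont_bounded[OF f] by auto
  have near: "\<bar>right_average L f x - 0\<bar> \<le> B" if "group_list L" "x \<in> carrier H" for L x
    using that B by (intro right_average_near) auto
  \<comment> \<open>The trivial average shows that \<open>T\<close> is nonempty; the uniform bound
    \<open>near\<close> makes it bounded below, so the infimum \<open>s\<close> is a genuine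
    one.\<close>
  have "group_list [\<one>]" by (simp add: group_list_def)
  moreover have "right_average [\<one>] f x \<le> B" if "x \<in> carrier H" for x
    using near[OF calculation that] by linarith
  ultimately have "B \<in> T" unfolding T_def by blast
  moreover have lb: "- B \<le> t" if t: "t \<in> T" for t
  proof -
    from t obtain L where "group_list L" "right_average L f \<one> \<le> t"
      unfolding T_def by blast
    with near[of L \<one>] show ?thesis by simp
  qed
  ultimately have bdd: "bdd_below T" "T \<noteq> {}" by (auto intro: bdd_belowI[of _ "- B"])
  have s_le: "s \<le> t" if "t \<in> T" for t
    using bdd that unfolding s_def by (intro cInf_lower)
  have "\<exists>L. group_list L \<and> (\<forall>x\<in>carrier H. \<bar>right_average L f x - s\<bar> \<le> e)" if e: "e > 0" for e
  proof -
    obtain U where U: "openin \<tau> U" "\<one> \<in> U"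
      "\<And>u x. u \<in> U \<Longrightarrow> x \<in> carrier H \<Longrightarrow> \<bar>f (u \<otimes> x) - f x\<bar> < e / 2"
      using uniform_neighbourhood[OF f, of "e / 2"] e by auto
    have UH: "U \<subseteq> carrier H" using U(1) openin_subset topspace_eq by auto
    obtain C where C: "group_list C" "\<And>x. x \<in> carrier H \<Longrightarrow> \<exists>c\<in>set C. x \<otimes> c \<in> U"
      using finite_translates_cover[OF U(1,2)] by blast
    define N where "N = real (length C)"
    have N: "N \<ge> 1" using C unfolding group_list_def N_def by (cases C) auto
    \<comment> \<open>One entry at most \<open>s - e / 2 = s - 2 * N * d\<close> and
      \<open>N - 1\<close> entries at most \<open>s + d\<close> sum to at most
      \<open>N * s - (N + 1) * d\<close>, which is below \<open>N * (s - d)\<close>.\<close>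
    define d where "d = e / (4 * N)"
    have d: "d > 0" "d \<le> e / 4" "N * d = e / 4"
      using e N by (auto simp: d_def field_simps)
    obtain t where "t \<in> T" "t < s + d"
      using cInf_lessD[OF bdd(2), of "s + d"] d by (auto simp: s_def)
    then obtain L where L: "group_list L" "\<And>x. x \<in> carrier H \<Longrightarrow> right_average L f x < s + d"
      unfolding T_def by fastforce
    let ?h = "right_average L f"
    have "s - e \<le> ?h x0" if x0: "x0 \<in> carrier H" for x0
    proof (rule ccontr)
      assume "\<not> s - e \<le> ?h x0"
      then have small: "?h (u \<otimes> x0) \<le> s - e / 2" if u: "u \<in> U" for u
      proof -
        have "?h (u \<otimes> x0) \<le> average L (\<lambda>g. e / 2 + f (x0 \<otimes> g))"
          unfolding right_average_def
        proof (rule average_mono)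
          fix g assume "g \<in> set L"
          then have "g \<in> carrier H" "u \<in> carrier H"
            using L UH u by (auto simp: group_list_def)
          then have "\<bar>f (u \<otimes> x0 \<otimes> g) - f (x0 \<otimes> g)\<bar> < e / 2"
            using U(3)[OF u, of "x0 \<otimes> g"] x0 by (simp only: m_assoc m_closed)
          then show "f (u \<otimes> x0 \<otimes> g) \<le> e / 2 + f (x0 \<otimes> g)" by linarith
        qed
        also have "\<dots> = e / 2 + ?h x0"
          using L by (simp add: average_add average_const group_list_def right_average_def)
        finally show ?thesis using \<open>\<not> s - e \<le> ?h x0\<close> by linarith
      qed
      \<comment> \<open>For every \<open>x\<close> some \<open>c\<close> in \<open>C\<close> has
        \<open>x \<otimes> c \<in> U\<close>; then \<open>x \<otimes> (c \<otimes> x0)\<close> lies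
        in the translate of \<open>U\<close> by \<open>x0\<close>, where \<open>small\<close>
        applies.\<close>
      define D where "D = map (\<lambda>c. c \<otimes> x0) C"
      have D: "group_list D" using C x0 by (auto simp: group_list_def D_def)
      have "right_average D ?h x \<le> s - d" if x: "x \<in> carrier H" for x
      proof -
        obtain c where c: "c \<in> set C" "x \<otimes> c \<in> U" using C x by blast
        have cH: "c \<in> carrier H" if "c \<in> set C" for c using that C by (auto simp: group_list_def)
        have eq: "right_average D ?h x = (\<Sum>c\<leftarrow>C. ?h (x \<otimes> (c \<otimes> x0))) / N"
          unfolding right_average_def[of D] unfolding D_def average_map unfolding average_def N_def ..
        have "(\<Sum>c\<leftarrow>C. ?h (x \<otimes> (c \<otimes> x0))) = ?h (x \<otimes> (c \<otimes> x0)) + (\<Sum>c\<leftarrow>remove1 c C. ?h (x \<otimes> (c \<otimes> x0)))"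
          using c by (intro sum_list_map_remove1)
        also have "?h (x \<otimes> (c \<otimes> x0)) \<le> s - e / 2"
          using small[OF c(2)] x x0 cH c by (simp add: m_assoc)
        also have "(\<Sum>c\<leftarrow>remove1 c C. ?h (x \<otimes> (c \<otimes> x0))) \<le> (\<Sum>c\<leftarrow>remove1 c C. s + d)"
        proof (rule sum_list_mono)
          fix c' assume "c' \<in> set (remove1 c C)"
          then have "c' \<in> carrier H" using cH by (meson notin_set_remove1)
          then show "?h (x \<otimes> (c' \<otimes> x0)) \<le> s + d" using x x0 by (intro less_imp_le L(2)) auto
        qed
        also have "(\<Sum>c\<leftarrow>remove1 c C. s + d) = (N - 1) * (s + d)"
          using c N by (simp add: sum_list_triv length_remove1 N_def of_nat_diff)
        also have "s - e / 2 + (N - 1) * (s + d) \<le> N * (s - d)"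
          using d by (simp add: algebra_simps)
        finally have "(\<Sum>c\<leftarrow>C. ?h (x \<otimes> (c \<otimes> x0))) \<le> N * (s - d)" by simp
        then show ?thesis unfolding eq using N by (simp add: pos_divide_le_eq mult.commute)
      qed
      \<comment> \<open>The average of an average is one average of \<open>f\<close>, so the bound
        \<open>s - d\<close> belongs to \<open>T\<close> and contradicts the choice of
        \<open>s\<close>.\<close>
      moreover obtain E where "group_list E"
        "\<And>x. x \<in> carrier H \<Longrightarrow> right_average D ?h x = right_average E f x"
        by (rule right_average_comp[OF D L(1)]) (rule that)
      ultimately have "group_list E \<and> (\<forall>x\<in>carrier H. right_average E f x \<le> s - d)" by simp
      then have "s - d \<in> T" unfolding T_def by blast
      then show False using s_le[of "s - d"] d by linarith
    qed
    moreover have "?h x \<le> s + e" if "x \<in> carrier H" for x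
      using L(2)[OF that] d e by linarith
    ultimately have "\<bar>?h x - s\<bar> \<le> e" if "x \<in> carrier H" for x
      using that by (simp add: abs_le_iff algebra_simps)
    with L show ?thesis by blast
  qed
  then show ?thesis unfolding right_mean_def by blast
qed

text \<open>Inversion is continuous and reverses products, so it turns right averages of
  \<open>f (inv x)\<close> into left averages of \<open>f\<close>.\<close>

lemma left_mean_exists:
  assumes f: "cont f"
  shows "\<exists>c. left_mean f c"
proof -
  obtain c where c: "right_mean (\<lambda>x. f (inv x)) c"
    using right_mean_exists[OF cont_inverse[OF f]] by blast
  have "\<exists>L. group_list L \<and> (\<forall>x\<in>carrier H. \<bar>left_average L f x - c\<bar> \<le> e)" if "e > 0" for e
  proof -
    obtain L where L: "group_list L"
      "\<And>x. x \<in> carrier H \<Longrightarrow> \<bar>right_average L (\<lambda>x. f (inv x)) x - c\<bar> \<le> e"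
      using c \<open>e > 0\<close> unfolding right_mean_def by blast
    have "left_average (map (\<lambda>g. inv g) L) f x = right_average L (\<lambda>x. f (inv x)) (inv x)"
      if "x \<in> carrier H" for x
      unfolding left_average_def right_average_def average_map
      using that L by (intro average_cong) (auto simp: group_list_def inv_mult_group subset_iff)
    moreover have "group_list (map (\<lambda>g. inv g) L)" using L by (auto simp: group_list_def)
    ultimately show ?thesis using L by (intro exI[of _ "map (\<lambda>g. inv g) L"]) auto
  qed
  then show ?thesis unfolding left_mean_def by blast
qed

section \<open>The invariant mean of a continuous real function\<close>

definition mean :: "('a \<Rightarrow> real) \<Rightarrow> real"
  where "mean f = (THE c. right_mean f c)"

text \<open>Any two right means agree because both equal one and the same left mean.\<close>

lemma mean_unique:
  assumes "cont f" "right_mean f c"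
  shows "mean f = c"
proof -
  obtain d where "left_mean f d" using left_mean_exists[OF assms(1)] by blast
  then have "c' = d" if "right_mean f c'" for c'
    using left_right_mean_unique that by metis
  with assms(2) show ?thesis unfolding mean_def by (metis the_equality)
qed

lemma right_mean_mean: "cont f \<Longrightarrow> right_mean f (mean f)"
  using right_mean_exists mean_unique by metis

lemma left_mean_mean: "cont f \<Longrightarrow> left_mean f (mean f)"
  using left_mean_exists right_mean_mean left_right_mean_unique by metis

text \<open>Right averaging preserves the left mean, which equals the mean. A one-element list gives
  right invariance.\<close>

lemma mean_right_average:
  assumes "cont f" "group_list L"
  shows "mean (right_average L f) = mean f"
proof -
  have "cont (right_average L f)"
    using assms cont_right_average group_list_def by blast
  moreover have "left_mean (right_average L f) (mean f)"
    using assms left_mean_mean left_mean_right_average by blast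
  ultimately show ?thesis
    using right_mean_mean left_right_mean_unique by metis
qed

lemma mean_rmult: "cont f \<Longrightarrow> g \<in> carrier H \<Longrightarrow> mean (\<lambda>x. f (x \<otimes> g)) = mean f"
  using mean_right_average[of f "[g]"]
  by (simp add: group_list_def right_average_def[abs_def] average_def)

lemma mean_ge:
  assumes f: "cont f" and "\<And>x. x \<in> carrier H \<Longrightarrow> a \<le> f x"
  shows "a \<le> mean f"
proof (rule field_le_epsilon)
  fix e :: real assume "e > 0"
  then obtain L where L: "group_list L" "\<bar>right_average L f \<one> - mean f\<bar> \<le> e"
    using right_mean_mean[OF f] unfolding right_mean_def by blast
  have "average L (\<lambda>_. a) \<le> right_average L f \<one>"
    unfolding right_average_def using L assms
    by (intro average_mono) (auto simp: group_list_def)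
  with L show "a \<le> mean f + e" by (simp add: average_const group_list_def)
qed

lemma mean_cmult:
  assumes f: "cont f"
  shows "mean (\<lambda>x. a * f x) = a * mean f"
proof (rule mean_unique)
  show "cont (\<lambda>x. a * f x)" using f by (intro continuous_map_real_mult) auto
  have "\<exists>L. group_list L \<and> (\<forall>x\<in>carrier H. \<bar>right_average L (\<lambda>x. a * f x) x - a * mean f\<bar> \<le> e)"
    if "e > 0" for e
  proof -
    \<comment> \<open>The summand 1 keeps the denominator positive when
      \<open>a = 0\<close>.\<close>
    from that have "e / (\<bar>a\<bar> + 1) > 0" by simp
    then obtain L where L: "group_list L"
        "\<forall>x\<in>carrier H. \<bar>right_average L f x - mean f\<bar> \<le> e / (\<bar>a\<bar> + 1)"
      using right_mean_mean[OF f] unfolding right_mean_def by blast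
    have "\<bar>right_average L (\<lambda>x. a * f x) x - a * mean f\<bar> \<le> e" if "x \<in> carrier H" for x
    proof -
      have "\<bar>right_average L (\<lambda>x. a * f x) x - a * mean f\<bar> = \<bar>a\<bar> * \<bar>right_average L f x - mean f\<bar>"
        by (simp add: right_average_def average_cmult flip: abs_mult right_diff_distrib)
      also have "\<dots> \<le> \<bar>a\<bar> * (e / (\<bar>a\<bar> + 1))"
        using L that by (intro mult_left_mono) auto
      also have "\<dots> \<le> e" using \<open>e > 0\<close> by (simp add: field_simps)
      finally show ?thesis .
    qed
    with L show ?thesis by blast
  qed
  then show "right_mean (\<lambda>x. a * f x) (a * mean f)" unfolding right_mean_def by blast
qed

text \<open>One list must serve both functions. First \<open>A\<close> makes \<open>f\<close> nearly
  constant; then \<open>B\<close> does so for the \<open>A\<close>-average of \<open>h\<close>,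
  whose mean is still \<open>mean h\<close>. Averaging over \<open>B\<close> does not spoil the
  estimate for \<open>f\<close>.\<close>

lemma mean_add:
  assumes f: "cont f" and h: "cont h"
  shows "mean (\<lambda>x. f x + h x) = mean f + mean h"
proof (rule mean_unique)
  show "cont (\<lambda>x. f x + h x)" using f h by (intro continuous_map_add)
  have "\<exists>L. group_list L \<and> (\<forall>x\<in>carrier H. \<bar>right_average L (\<lambda>x. f x + h x) x - (mean f + mean h)\<bar> \<le> e)"
    if "e > 0" for e
  proof -
    from that have e2: "e / 2 > 0" by simp
    then obtain A where A: "group_list A"
        "\<forall>x\<in>carrier H. \<bar>right_average A f x - mean f\<bar> \<le> e / 2"
      using right_mean_mean[OF f] unfolding right_mean_def by blast
    have "cont (right_average A h)" using A h cont_right_average group_list_def by blast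
    then have "right_mean (right_average A h) (mean h)"
      using right_mean_mean mean_right_average[OF h A(1)] by metis
    then obtain B where B: "group_list B"
        "\<forall>x\<in>carrier H. \<bar>right_average B (right_average A h) x - mean h\<bar> \<le> e / 2"
      using e2 unfolding right_mean_def by blast
    obtain L where L: "group_list L"
      "\<And>f x. x \<in> carrier H \<Longrightarrow> right_average B (right_average A f) x = right_average L f x"
      by (rule right_average_comp[OF B(1) A(1)]) (rule that)
    have "\<bar>right_average L (\<lambda>x. f x + h x) x - (mean f + mean h)\<bar> \<le> e" if x: "x \<in> carrier H" for x
    proof -
      have "\<bar>right_average L f x - mean f\<bar> \<le> e / 2"
        using right_average_near[OF B(1), of "right_average A f" "mean f" "e/2" x] A x L by simp
      moreover have "\<bar>right_average L h x - mean h\<bar> \<le> e / 2"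
        using B x L by simp
      moreover have "right_average L (\<lambda>x. f x + h x) x = right_average L f x + right_average L h x"
        by (simp add: right_average_def average_add)
      ultimately show ?thesis by linarith
    qed
    with L show ?thesis by blast
  qed
  then show "right_mean (\<lambda>x. f x + h x) (mean f + mean h)" unfolding right_mean_def by blast
qed

section \<open>The mean of complex-valued functions\<close>

lemma cont_compose: "continuous_on UNIV h \<Longrightarrow> cont f \<Longrightarrow> cont (\<lambda>x. h (f x))"
  using continuous_map_compose[of \<tau> euclidean f euclidean h] by (simp add: comp_def)

definition cmean :: "('a \<Rightarrow> complex) \<Rightarrow> complex"
  where "cmean f = Complex (mean (\<lambda>x. Re (f x))) (mean (\<lambda>x. Im (f x)))"

lemma cont_Re: "cont f \<Longrightarrow> cont (\<lambda>x. Re (f x))"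
  by (rule cont_compose) (auto intro!: continuous_intros)

lemma cont_Im: "cont f \<Longrightarrow> cont (\<lambda>x. Im (f x))"
  by (rule cont_compose) (auto intro!: continuous_intros)

lemma cont_cmult: "cont f \<Longrightarrow> cont (\<lambda>x. c * f x)" for c :: complex
  by (rule cont_compose) (auto intro!: continuous_intros)

lemma cmean_add: "cont f \<Longrightarrow> cont g \<Longrightarrow> cmean (\<lambda>x. f x + g x) = cmean f + cmean g"
  by (simp add: cmean_def mean_add cont_Re cont_Im complex_eq_iff)

lemma cmean_cmult:
  assumes f: "cont f"
  shows "cmean (\<lambda>x. c * f x) = c * cmean f"
proof -
  have Re: "cont (\<lambda>x. a * Re (f x))" and Im: "cont (\<lambda>x. a * Im (f x))" for a
    by (intro cont_compose[of "\<lambda>t. a * t"] cont_Re cont_Im f continuous_intros)+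
  have "mean (\<lambda>x. Re c * Re (f x) - Im c * Im (f x)) = mean (\<lambda>x. Re c * Re (f x) + (- Im c) * Im (f x))"
    by simp
  then show ?thesis
    using mean_add[OF Re[of "Re c"] Im[of "- Im c"]] mean_add[OF Re[of "Im c"] Im[of "Re c"]]
      mean_cmult[OF cont_Re[OF f]] mean_cmult[OF cont_Im[OF f]] mean_add[OF Im[of "Re c"] Re[of "Im c"]]
      mean_cmult[OF cont_Im[OF f], of "- Im c"]
    by (simp add: cmean_def complex_eq_iff)
qed

lemma cmean_rmult: "cont f \<Longrightarrow> g \<in> carrier H \<Longrightarrow> cmean (\<lambda>x. f (x \<otimes> g)) = cmean f"
  using mean_rmult[OF cont_Re] mean_rmult[OF cont_Im] by (simp add: cmean_def)

lemma Re_cmean: "Re (cmean f) = mean (\<lambda>x. Re (f x))"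
  by (simp add: cmean_def)

lemma norm_cmean_le:
  assumes f: "cont f" and B: "\<And>x. x \<in> carrier H \<Longrightarrow> norm (f x) \<le> B"
  shows "norm (cmean f) \<le> B"
proof (cases "cmean f = 0")
  case True
  have "0 \<le> norm (f \<one>)" by simp
  also have "\<dots> \<le> B" using B by simp
  finally show ?thesis using True by simp
next
  case False
  \<comment> \<open>The unimodular factor \<open>u\<close> rotates the mean onto the negative real
    axis, where the lower bound \<open>mean_ge\<close> for real parts controls its modulus.\<close>
  define u where "u = - cnj (cmean f) / norm (cmean f)"
  have "u * cmean f = - norm (cmean f)"
    using False complex_norm_square[of "cmean f"]
    by (simp add: u_def power2_eq_square mult.commute nonzero_divide_eq_eq)
  then have "Re (cmean (\<lambda>x. u * f x)) = - norm (cmean f)"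
    using cmean_cmult[OF f, of u] by simp
  moreover have "- B \<le> Re (cmean (\<lambda>x. u * f x))"
    unfolding Re_cmean
  proof (rule mean_ge)
    show "cont (\<lambda>x. Re (u * f x))" by (intro cont_Re cont_cmult f)
    fix x assume "x \<in> carrier H"
    have "norm (u * f x) = norm (f x)" using False by (simp add: u_def norm_mult norm_divide)
    then show "- B \<le> Re (u * f x)"
      using B[OF \<open>x \<in> carrier H\<close>] abs_Re_le_cmod[of "u * f x"] by linarith
  qed
  ultimately show ?thesis by simp
qed

lemma norm_cmean_diff_le:
  assumes "cont f" "cont g" "\<And>x. x \<in> carrier H \<Longrightarrow> norm (f x - g x) \<le> e"
  shows "norm (cmean f - cmean g) \<le> e"
proof -
  have neg: "cont (\<lambda>x. - 1 * g x)" by (rule cont_cmult[OF assms(2)])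
  have "cmean (\<lambda>x. f x + - 1 * g x) = cmean f - cmean g"
    unfolding cmean_add[OF assms(1) neg] cmean_cmult[OF assms(2)] by simp
  moreover have "cont (\<lambda>x. f x + - 1 * g x)"
    using assms(1) neg by (rule continuous_map_add)
  ultimately show ?thesis
    using norm_cmean_le[of "\<lambda>x. f x + - 1 * g x" e] assms(3) by simp
qed

text \<open>Extending the mean, by linearity alone, to discontinuous functions means that the multilinear
  forms which represent a continuous polynomial need not be continuous themselves.\<close>

lemma cmean_extension:
  obtains m :: "('a \<Rightarrow> complex) \<Rightarrow> complex"
  where "\<And>f g. m (\<lambda>x. f x + g x) = m f + m g" "\<And>c f. m (\<lambda>x. c * f x) = c * m f"
    "\<And>f. cont f \<Longrightarrow> m f = cmean f"
proof -
  let ?s = "\<lambda>(c::complex) (f::'a \<Rightarrow> complex) x. c * f x"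
  interpret V: vector_space_pair ?s "(*) :: complex \<Rightarrow> complex \<Rightarrow> complex"
    by unfold_locales (simp_all add: fun_eq_iff algebra_simps)
  have "cont (\<lambda>x. 0 :: complex)" by simp
  then have zero: "cmean (\<lambda>x. 0) = 0" using cmean_cmult[of "\<lambda>x. 0" 0] by simp
  \<comment> \<open>A basis of the space of continuous functions; \<open>m\<close> is prescribed on
    it and extended linearly to all functions.\<close>
  obtain B where B: "B \<subseteq> {f. cont f}" "V.vs1.independent B" "{f. cont f} \<subseteq> V.vs1.span B"
    using V.vs1.maximal_independent_subset by blast
  obtain m where m: "Vector_Spaces.linear ?s (*) m" "\<forall>f\<in>B. m f = cmean f"
    using V.linear_independent_extend[OF B(2)] by blast
  have add: "m (\<lambda>x. f x + g x) = m f + m g" for f g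
    using V.linear_add[OF m(1), of f g] by (simp add: plus_fun_def)
  have cmult: "m (\<lambda>x. c * f x) = c * m f" for c f
    using V.linear_scale[OF m(1), of c f] by simp
  \<comment> \<open>Continuity is carried through the induction because additivity and homogeneity
    of \<open>cmean\<close> are available for continuous functions.\<close>
  have "cont f \<and> m f = cmean f" if "f \<in> V.vs1.span B" for f
  proof (rule V.vs1.span_induct[OF that])
    show "V.vs1.subspace {f. cont f \<and> m f = cmean f}"
    proof (rule V.vs1.subspaceI)
      show "0 \<in> {f. cont f \<and> m f = cmean f}"
        using V.linear_0[OF m(1)] zero by (simp add: zero_fun_def)
    qed (simp_all add: plus_fun_def add cmult cmean_add cmean_cmult cont_cmult continuous_map_add)
    show "cont f \<and> m f = cmean f" if "f \<in> B" for f
      using that B(1) m(2) by blast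
  qed
  with B(3) have "m f = cmean f" if "cont f" for f using that by blast
  with add cmult that show ?thesis by blast
qed

end

section \<open>Polynomials\<close>

lemma clinear_iff:
  "clinear f \<longleftrightarrow> (\<forall>x y. f (x + y) = f x + f y) \<and> (\<forall>c x. f (c *\<^sub>C x) = c *\<^sub>C f x)"
  by (simp add: Vector_Spaces.linear_iff vector_space_scaleC)

lemma clinear_complex_iff:
  "clinear f \<longleftrightarrow> (\<forall>x y. f (x + y) = f x + f y) \<and> (\<forall>c x. f (c *\<^sub>C x) = c * f x)"
  for f :: "'a::complex_normed_vector \<Rightarrow> complex"
  by (simp add: clinear_iff scaleC_complex_def)

lemma clinear_imp_linear: "clinear f \<Longrightarrow> linear f"
  by (intro linearI) (simp_all add: clinear_iff flip: scaleC_of_real)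

lemma homogeneous_polynomialI:
  assumes "multilinear_form k A" "\<And>x. P x = A (\<lambda>i\<in>{..<k}. x)"
  shows "homogeneous_polynomial k P"
  using assms unfolding homogeneous_polynomial_def by blast

lemma homogeneous_polynomialE:
  assumes "homogeneous_polynomial k P"
  obtains A where "multilinear_form k A" "\<And>x. P x = A (\<lambda>i\<in>{..<k}. x)"
  using assms unfolding homogeneous_polynomial_def by auto

lemma homogeneous_polynomial_zero: "homogeneous_polynomial k (\<lambda>x. 0)"
  by (rule homogeneous_polynomialI[of _ "\<lambda>x. 0"]) (simp_all add: multilinear_form_def clinear_complex_iff)

lemma homogeneous_polynomial_const: "homogeneous_polynomial 0 (\<lambda>x. c)"
  by (rule homogeneous_polynomialI[of _ "\<lambda>x. c"]) (simp_all add: multilinear_form_def)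

lemma homogeneous_polynomial_add:
  assumes "homogeneous_polynomial k P" "homogeneous_polynomial k Q"
  shows "homogeneous_polynomial k (\<lambda>x. P x + Q x)"
proof -
  obtain A B where "multilinear_form k A" "\<And>x. P x = A (\<lambda>i\<in>{..<k}. x)"
    "multilinear_form k B" "\<And>x. Q x = B (\<lambda>i\<in>{..<k}. x)"
    using assms homogeneous_polynomialE by metis
  then show ?thesis
    by (intro homogeneous_polynomialI[of _ "\<lambda>x. A x + B x"])
      (simp_all add: multilinear_form_def clinear_complex_iff algebra_simps)
qed

text \<open>The product form feeds the first \<open>j\<close> slots to \<open>A\<close> and the next
  \<open>k\<close> to \<open>B\<close>, so changing one slot affects one factor. Restricting
  \<open>?l\<close> and \<open>?r\<close> keeps the tuples extensional.\<close>

lemma homogeneous_polynomial_mult: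
  assumes "homogeneous_polynomial j P" "homogeneous_polynomial k Q"
  shows "homogeneous_polynomial (j + k) (\<lambda>x. P x * Q x)"
proof -
  obtain A where A: "multilinear_form j A" "\<And>x. P x = A (\<lambda>i\<in>{..<j}. x)"
    using assms homogeneous_polynomialE by metis
  obtain B where B: "multilinear_form k B" "\<And>x. Q x = B (\<lambda>i\<in>{..<k}. x)"
    using assms homogeneous_polynomialE by metis
  let ?l = "\<lambda>x. \<lambda>i\<in>{..<j}. x i" and ?r = "\<lambda>x. \<lambda>i\<in>{..<k}. x (j + i)"
  have "clinear (\<lambda>y. A (?l (x(i := y))) * B (?r (x(i := y))))" if i: "i < j + k" for i and x :: "nat \<Rightarrow> 'a"
  proof (cases "i < j")
    case True
    have "?l (x(i := y)) = (?l x)(i := y)" "?r (x(i := y)) = ?r x" for y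
      using True by auto
    moreover have "clinear (\<lambda>y. A ((?l x)(i := y)))"
      using A(1) True by (auto simp: multilinear_form_def)
    ultimately show ?thesis by (simp add: clinear_complex_iff algebra_simps)
  next
    case False
    have "?l (x(i := y)) = ?l x" "?r (x(i := y)) = (?r x)(i - j := y)" for y
      using False i by (auto simp: fun_eq_iff)
    moreover have "clinear (\<lambda>y. B ((?r x)(i - j := y)))"
      using B(1) i False by (auto simp: multilinear_form_def)
    ultimately show ?thesis by (simp add: clinear_complex_iff algebra_simps)
  qed
  then have "multilinear_form (j + k) (\<lambda>x. A (?l x) * B (?r x))"
    unfolding multilinear_form_def by blast
  moreover have "?l (\<lambda>i\<in>{..<j + k}. x) = (\<lambda>i\<in>{..<j}. x)" "?r (\<lambda>i\<in>{..<j + k}. x) = (\<lambda>i\<in>{..<k}. x)"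
    for x :: 'a by auto
  ultimately have "P x * Q x = A (?l (\<lambda>i\<in>{..<j + k}. x)) * B (?r (\<lambda>i\<in>{..<j + k}. x))" for x
    unfolding A(2) B(2) by metis
  with \<open>multilinear_form (j + k) (\<lambda>x. A (?l x) * B (?r x))\<close> show ?thesis
    by (rule homogeneous_polynomialI)
qed

lemma homogeneous_polynomial_power:
  "homogeneous_polynomial k P \<Longrightarrow> homogeneous_polynomial (k * n) (\<lambda>x. P x ^ n)"
  by (induction n) (simp_all add: homogeneous_polynomial_const homogeneous_polynomial_mult)

section \<open>Polynomials as sums of homogeneous components\<close>

lemma homogeneous_imp_polynomial:
  assumes "homogeneous_polynomial k P"
  shows "polynomial P"
proof -
  let ?p = "\<lambda>i x. if i = k then P x else 0"
  have "P = (\<lambda>x. \<Sum>i\<le>k. ?p i x)" by simp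
  moreover have "homogeneous_polynomial i (?p i)" for i
    using assms homogeneous_polynomial_zero by (cases "i = k") simp_all
  ultimately show ?thesis
    unfolding polynomial_def by (intro exI[of _ k] exI[of _ ?p] conjI allI impI)
qed

text \<open>Padding with zero components allows two polynomials to be expanded up to a common
  degree.\<close>

lemma polynomialE:
  assumes "polynomial P"
  obtains n p where "\<And>k. homogeneous_polynomial k (p k)" "\<And>N x. n \<le> N \<Longrightarrow> P x = (\<Sum>k\<le>N. p k x)"
proof -
  obtain n p where p: "\<forall>k\<le>n. homogeneous_polynomial k (p k)" "P = (\<lambda>x. \<Sum>k\<le>n. p k x)"
    using assms unfolding polynomial_def by blast
  show ?thesis
  proof
    show "homogeneous_polynomial k (if k \<le> n then p k else (\<lambda>x. 0))" for k
      using p homogeneous_polynomial_zero by auto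
    show "P x = (\<Sum>k\<le>N. (if k \<le> n then p k else (\<lambda>x. 0)) x)" if "n \<le> N" for N x
      unfolding p(2) using that by (intro sum.mono_neutral_cong_left) auto
  qed
qed

lemma polynomial_add:
  assumes "polynomial P" "polynomial Q"
  shows "polynomial (\<lambda>x. P x + Q x)"
proof -
  obtain n p where p: "\<And>k. homogeneous_polynomial k (p k)" "\<And>N x. n \<le> N \<Longrightarrow> P x = (\<Sum>k\<le>N. p k x)"
    by (rule polynomialE[OF assms(1)]) (rule that)
  obtain m q where q: "\<And>k. homogeneous_polynomial k (q k)" "\<And>N x. m \<le> N \<Longrightarrow> Q x = (\<Sum>k\<le>N. q k x)"
    by (rule polynomialE[OF assms(2)]) (rule that)
  show ?thesis
    unfolding polynomial_def
  proof (intro exI conjI allI impI)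
    show "homogeneous_polynomial k (\<lambda>x. p k x + q k x)" for k
      by (rule homogeneous_polynomial_add[OF p(1) q(1)])
    show "(\<lambda>x. P x + Q x) = (\<lambda>x. \<Sum>k\<le>max n m. p k x + q k x)"
      unfolding sum.distrib p(2)[OF max.cobounded1[of n m]] q(2)[OF max.cobounded2[of m n]] ..
  qed
qed

lemma polynomial_const: "polynomial (\<lambda>x. c)"
  by (rule homogeneous_imp_polynomial[OF homogeneous_polynomial_const])

lemma polynomial_sum:
  assumes "finite I" "\<And>i. i \<in> I \<Longrightarrow> polynomial (P i)"
  shows "polynomial (\<lambda>x. \<Sum>i\<in>I. P i x)"
  using assms
proof (induction I)
  case empty
  then show ?case by (simp add: polynomial_const)
next
  case (insert i I)
  then have "polynomial (\<lambda>x. P i x + (\<Sum>i\<in>I. P i x))" by (intro polynomial_add) simp_all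
  with insert.hyps show ?case by simp
qed

lemma polynomial_mult:
  assumes "polynomial P" "polynomial Q"
  shows "polynomial (\<lambda>x. P x * Q x)"
proof -
  obtain n p where p: "\<And>k. homogeneous_polynomial k (p k)" "\<And>N x. n \<le> N \<Longrightarrow> P x = (\<Sum>k\<le>N. p k x)"
    by (rule polynomialE[OF assms(1)]) (rule that)
  obtain m q where q: "\<And>k. homogeneous_polynomial k (q k)" "\<And>N x. m \<le> N \<Longrightarrow> Q x = (\<Sum>k\<le>N. q k x)"
    by (rule polynomialE[OF assms(2)]) (rule that)
  have "polynomial (\<lambda>x. \<Sum>i\<le>n. \<Sum>j\<le>m. p i x * q j x)"
    using homogeneous_imp_polynomial[OF homogeneous_polynomial_mult[OF p(1) q(1)]]
    by (intro polynomial_sum finite_atMost)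
  then show ?thesis unfolding p(2)[OF order_refl] q(2)[OF order_refl] sum_product .
qed

lemma polynomial_power: "polynomial P \<Longrightarrow> polynomial (\<lambda>x. P x ^ n)"
  by (induction n) (simp_all add: polynomial_const polynomial_mult)

text \<open>Apply \<open>m\<close> to the family, indexed by \<open>b\<close>, of forms obtained
  from \<open>A\<close> by putting \<open>T b\<close> into each slot. Linearity of \<open>m\<close>
  gives linearity in each slot. The value 0 off \<open>I\<close> makes the identities hold for all
  \<open>b\<close>, although \<open>T b\<close> is known to be linear only for \<open>b\<close> in
  \<open>I\<close>.\<close>

lemma homogeneous_polynomial_functional:
  fixes m :: "('b \<Rightarrow> complex) \<Rightarrow> complex" and T :: "'b \<Rightarrow> 'a::complex_normed_vector \<Rightarrow> 'a"
  assumes P: "homogeneous_polynomial k P"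
    and m: "\<And>f g. m (\<lambda>x. f x + g x) = m f + m g" "\<And>c f. m (\<lambda>x. c * f x) = c * m f"
    and T: "\<And>b. b \<in> I \<Longrightarrow> clinear (T b)"
  shows "homogeneous_polynomial k (\<lambda>x. m (\<lambda>b. if b \<in> I then P (T b x) else 0))"
proof -
  obtain A where A: "multilinear_form k A" "\<And>x. P x = A (\<lambda>i\<in>{..<k}. x)"
    by (rule homogeneous_polynomialE[OF P]) (rule that)
  let ?T = "\<lambda>b x. \<lambda>i\<in>{..<k}. T b (x i)"
  have "clinear (\<lambda>y. m (\<lambda>b. if b \<in> I then A (?T b (x(i := y))) else 0))" if i: "i < k" for i x
  proof -
    have eq: "?T b (x(i := y)) = (?T b x)(i := T b y)" for b y
      using i by auto
    have "clinear (\<lambda>y. A ((?T b x)(i := y)))" for b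
      using A(1) i by (auto simp: multilinear_form_def)
    then have lin: "A ((?T b x)(i := T b (y + y'))) = A ((?T b x)(i := T b y)) + A ((?T b x)(i := T b y'))"
        "A ((?T b x)(i := T b (c *\<^sub>C y))) = c * A ((?T b x)(i := T b y))" if "b \<in> I" for b c y y'
      using T[OF that] by (simp_all add: clinear_complex_iff clinear_iff)
    have "(\<lambda>b. if b \<in> I then A (?T b (x(i := y + y'))) else 0) =
        (\<lambda>b. (if b \<in> I then A (?T b (x(i := y))) else 0) + (if b \<in> I then A (?T b (x(i := y'))) else 0))"
      and "(\<lambda>b. if b \<in> I then A (?T b (x(i := c *\<^sub>C y))) else 0) =
        (\<lambda>b. c * (if b \<in> I then A (?T b (x(i := y))) else 0))" for c y y'
      unfolding eq by (simp_all add: lin fun_eq_iff)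
    then show ?thesis by (simp add: clinear_complex_iff m)
  qed
  then have "multilinear_form k (\<lambda>x. m (\<lambda>b. if b \<in> I then A (?T b x) else 0))"
    unfolding multilinear_form_def by blast
  then show ?thesis
  proof (rule homogeneous_polynomialI)
    have eq: "?T b (\<lambda>i\<in>{..<k}. x) = (\<lambda>i\<in>{..<k}. T b x)" for b x by auto
    show "m (\<lambda>b. if b \<in> I then P (T b x) else 0) =
        m (\<lambda>b. if b \<in> I then A (?T b (\<lambda>i\<in>{..<k}. x)) else 0)" for x
      unfolding eq A(2) ..
  qed
qed

lemma polynomial_functional:
  fixes m :: "('b \<Rightarrow> complex) \<Rightarrow> complex" and T :: "'b \<Rightarrow> 'a::complex_normed_vector \<Rightarrow> 'a"
  assumes P: "polynomial P"
    and m: "\<And>f g. m (\<lambda>x. f x + g x) = m f + m g" "\<And>c f. m (\<lambda>x. c * f x) = c * m f"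
    and T: "\<And>b. b \<in> I \<Longrightarrow> clinear (T b)"
  shows "polynomial (\<lambda>x. m (\<lambda>b. if b \<in> I then P (T b x) else 0))"
proof -
  obtain n p where p: "\<And>k. homogeneous_polynomial k (p k)" "\<And>N x. n \<le> N \<Longrightarrow> P x = (\<Sum>k\<le>N. p k x)"
    by (rule polynomialE[OF P]) (rule that)
  have m0: "m (\<lambda>x. 0) = 0" using m(2)[of 0 "\<lambda>x. 0"] by simp
  have m_sum: "m (\<lambda>x. \<Sum>k\<in>J. f k x) = (\<Sum>k\<in>J. m (f k))" if "finite J" for J :: "nat set" and f
    using that by (induction J) (simp_all add: m0 m(1))
  have "polynomial (\<lambda>x. \<Sum>k\<le>n. m (\<lambda>b. if b \<in> I then p k (T b x) else 0))"
    using homogeneous_imp_polynomial[OF homogeneous_polynomial_functional[where m = m and T = T and I = I, OF p(1) m T]]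
    by (intro polynomial_sum finite_atMost)
  moreover have "(\<lambda>b. if b \<in> I then P (T b x) else 0) =
      (\<lambda>b. \<Sum>k\<le>n. if b \<in> I then p k (T b x) else 0)" for x
    by (auto simp: fun_eq_iff p(2)[of n])
  ultimately show ?thesis by (simp add: m_sum)
qed

section \<open>Analytic preliminaries\<close>

text \<open>Banach-Steinhaus: the closed sets \<open>?E n\<close> cover a complete space, so by
  Baire's theorem one of them contains a ball.\<close>

lemma uniform_boundedness:
  fixes F :: "('a::banach \<Rightarrow> 'b::real_normed_vector) set"
  assumes lin: "\<And>f. f \<in> F \<Longrightarrow> linear f" and cont: "\<And>f. f \<in> F \<Longrightarrow> continuous_on UNIV f"
    and bdd: "\<And>x. \<exists>b. \<forall>f\<in>F. norm (f x) \<le> b"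
  obtains M where "M > 0" "\<And>f x. f \<in> F \<Longrightarrow> norm (f x) \<le> M * norm x"
proof -
  let ?E = "\<lambda>n::nat. {x. \<forall>f\<in>F. norm (f x) \<le> real n}"
  have closed: "closed (?E n)" for n
  proof -
    have "?E n = (\<Inter>f\<in>F. {x. norm (f x) \<le> real n})" by auto
    moreover have "closed {x. norm (f x) \<le> real n}" if "f \<in> F" for f
      using cont[OF that] by (intro closed_Collect_le continuous_intros)
    ultimately show ?thesis by auto
  qed
  have "x \<in> \<Union>(range ?E)" for x
  proof -
    obtain b where b: "\<forall>f\<in>F. norm (f x) \<le> b" using bdd by blast
    obtain n :: nat where "b \<le> real n" using real_arch_simple by blast
    with b have "x \<in> ?E n" by force
    then show ?thesis by blast
  qed
  then have "\<Union>(range ?E) = UNIV" by blast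
  then have nonempty: "euclidean interior_of \<Union>(range ?E) \<noteq> {}" by simp
  have "\<exists>n. interior (?E n) \<noteq> {}"
  proof (rule ccontr)
    assume "\<nexists>n. interior (?E n) \<noteq> {}"
    then have "closedin euclidean T \<and> euclidean interior_of T = {}" if "T \<in> range ?E" for T
      using closed that by auto
    then have "euclidean interior_of \<Union>(range ?E) = {}"
      by (intro Baire_category_alt disjI1 completely_metrizable_space_euclidean) simp_all
    with nonempty show False by contradiction
  qed
  then obtain n where "interior (?E n) \<noteq> {}" ..
  then obtain x0 where "x0 \<in> interior (?E n)" by blast
  then obtain r where r: "r > 0" "cball x0 r \<subseteq> ?E n"
    unfolding mem_interior_cball by blast
  have bound: "norm (f x) \<le> (2 * real n / r + 1) * norm x" if f: "f \<in> F" for f x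
  proof (cases "x = 0")
    case True
    then show ?thesis using linear_0[OF lin[OF f]] by simp
  next
    case False
    \<comment> \<open>Rescaled to norm \<open>r\<close>, so that \<open>f ?y\<close> is the
      difference of two values on the ball and has norm at most \<open>2 * n\<close>.\<close>
    let ?y = "(r / norm x) *\<^sub>R x"
    have "x0 + ?y \<in> cball x0 r" "x0 \<in> cball x0 r"
      using False r by (simp_all add: dist_norm)
    then have "norm (f (x0 + ?y)) \<le> n" "norm (f x0) \<le> n" using r f by blast+
    moreover have "f (x0 + ?y) = f x0 + (r / norm x) *\<^sub>R f x"
      using lin[OF f] by (simp add: linear_add linear_scale)
    ultimately have "norm ((r / norm x) *\<^sub>R f x) \<le> 2 * n"
      using norm_triangle_ineq4[of "f (x0 + ?y)" "f x0"] by simp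
    then have "norm (f x) \<le> 2 * real n / r * norm x"
      using r False by (simp add: field_simps)
    also have "\<dots> \<le> (2 * real n / r + 1) * norm x" by (simp add: algebra_simps)
    finally show ?thesis .
  qed
  have pos: "2 * real n / r + 1 > 0" using r by (simp add: add_nonneg_pos)
  show ?thesis by (rule that[OF pos]) (rule bound)
qed

text \<open>A Lebesgue number for the cover of \<open>C\<close> by preimages of balls of radius
  \<open>e / 2\<close>. Only \<open>c\<close> has to lie in \<open>C\<close>, which lets a compact
  orbit be compared with nearby points off it.\<close>

lemma compact_uniform_continuity:
  assumes "compact C" "continuous_on UNIV f" "e > 0"
  obtains d where "d > 0" "\<And>c y. c \<in> C \<Longrightarrow> dist y c < d \<Longrightarrow> dist (f y) (f c) < e"
proof -
  let ?B = "\<lambda>c. f -` ball (f c) (e / 2)"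
  have "open (?B c)" for c using assms(2) by (intro open_vimage) auto
  then have opn: "\<And>G. G \<in> ?B ` C \<Longrightarrow> open G" by blast
  have cover: "C \<subseteq> \<Union>(?B ` C)" using assms(3) by auto
  obtain d where d: "d > 0" "\<And>c. c \<in> C \<Longrightarrow> \<exists>G\<in>?B ` C. ball c d \<subseteq> G"
    by (rule Heine_Borel_lemma[OF assms(1) cover opn]) (assumption | rule that)+
  have close: "dist (f y) (f c) < e" if c: "c \<in> C" "dist y c < d" for c y
  proof -
    obtain c' where c': "ball c d \<subseteq> ?B c'" using d(2)[OF c(1)] by blast
    have "y \<in> ball c d" "c \<in> ball c d" using c d(1) by (simp_all add: dist_commute)
    with c' have "y \<in> ?B c'" "c \<in> ?B c'" by blast+
    then have "dist (f c') (f y) < e / 2" "dist (f c') (f c) < e / 2" by simp_all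
    then show ?thesis by (rule dist_triangle_half_r)
  qed
  show ?thesis by (rule that[OF d(1) close])
qed

text \<open>Dirichlet approximation to within 1/6 of a turn puts every angle within
  \<open>pi / 3\<close> of a multiple of \<open>2 * pi\<close>. The angles are first scaled by
  \<open>N'\<close>, so that the resulting multiplier \<open>n = nat q * N'\<close> is at least
  \<open>N\<close>.\<close>

lemma simultaneous_cos_ge_half:
  assumes "finite A"
  obtains n where "N \<le> n" "\<And>t. t \<in> A \<Longrightarrow> 1 / 2 \<le> cos (real n * t)"
proof -
  obtain a and k :: nat where a: "A = a ` {i. i < k}"
    using finite_imp_nat_seg_image_inj_on[OF assms] by blast
  define N' where "N' = Suc N"
  obtain q p where q: "0 < q" "\<And>i. i < k \<Longrightarrow>
      \<bar>of_int q * (real N' * a i / (2 * pi)) - of_int (p i)\<bar> < 1 / real 6"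
    by (rule Dirichlet_approx_simult[of 6 k "\<lambda>i. real N' * a i / (2 * pi)"]) (simp, rule that)
  define n where "n = nat q * N'"
  have "1 / 2 \<le> cos (real n * a i)" if i: "i < k" for i
  proof -
    let ?d = "real n * a i - 2 * pi * of_int (p i)"
    have "?d = 2 * pi * (of_int q * (real N' * a i / (2 * pi)) - of_int (p i))"
      using q(1) by (simp add: n_def field_simps)
    then have "\<bar>?d\<bar> = 2 * pi * \<bar>of_int q * (real N' * a i / (2 * pi)) - of_int (p i)\<bar>"
      by (simp add: abs_mult)
    also have "\<dots> \<le> 2 * pi * (1 / 6)"
      using q(2)[OF i] by (intro mult_left_mono) simp_all
    finally have "\<bar>?d\<bar> \<le> pi / 3" by simp
    then have "cos (pi / 3) \<le> cos \<bar>?d\<bar>" by (intro cos_monotone_0_pi_le) auto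
    also have "cos \<bar>?d\<bar> = cos (real n * a i)"
      using cos_int_2pin sin_int_2pin by (simp add: cos_diff mult.commute)
    finally show ?thesis by (simp add: cos_60)
  qed
  moreover have "N \<le> n"
  proof -
    have "1 * N \<le> nat q * N'" using q(1) by (intro mult_mono) (auto simp: N'_def)
    then show ?thesis by (simp add: n_def)
  qed
  ultimately show ?thesis using that a by blast
qed

lemma Re_power_Arg2pi: "Re (w ^ n) = cmod w ^ n * cos (real n * Arg2pi w)"
proof -
  have "w = complex_of_real (cmod w) * cis (Arg2pi w)"
    using Arg2pi[of w] by (simp add: cis_conv_exp is_Arg_def)
  then have "w ^ n = (complex_of_real (cmod w) * cis (Arg2pi w)) ^ n" by (rule arg_cong)
  also have "\<dots> = complex_of_real (cmod w ^ n) * cis (real n * Arg2pi w)"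
    by (simp add: power_mult_distrib Complex.DeMoivre)
  finally have "Re (w ^ n) = Re (complex_of_real (cmod w ^ n) * cis (real n * Arg2pi w))"
    by (rule arg_cong)
  then show ?thesis by (simp del: of_real_power)
qed

section \<open>Averaging over a compact group of operators\<close>

locale compact_operator_action =
  fixes G :: "('a::complex_banach \<Rightarrow> 'a) set" and \<tau> :: "('a \<Rightarrow> 'a) topology"
  assumes operator_group: "compact_operator_group G \<tau>"
    and action: "acts_separately_continuously G \<tau>"
begin

sublocale compact_group "composition_monoid G" \<tau>
  using operator_group
  by (auto simp: compact_operator_group_def topological_group_def
      intro!: compact_group.intro compact_group_axioms.intro)

lemma carrier_eq: "carrier (composition_monoid G) = G"
  and mult_eq: "\<gamma> \<otimes>\<^bsub>composition_monoid G\<^esub> \<delta> = \<gamma> \<circ> \<delta>"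
  and one_eq: "\<one>\<^bsub>composition_monoid G\<^esub> = id"
  by (simp_all add: composition_monoid_def)

lemma topspace_G: "topspace \<tau> = G"
  using topspace_eq by (simp add: carrier_eq)

lemma comp_in_G: "\<gamma> \<in> G \<Longrightarrow> \<delta> \<in> G \<Longrightarrow> \<gamma> \<circ> \<delta> \<in> G"
  using m_closed by (simp add: carrier_eq mult_eq)

lemma clinear_G: "\<gamma> \<in> G \<Longrightarrow> clinear \<gamma>"
  using operator_group by (auto simp: compact_operator_group_def continuous_operators_def)

lemma cont_orbit: "cont (\<lambda>\<gamma>. \<gamma> x)"
  using action by (simp add: acts_separately_continuously_def)

text \<open>The default 0 off \<open>G\<close> gives the integrand the shape required by
  \<open>polynomial_functional\<close>, where linearity is assumed only on the index set.\<close>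

definition along_orbit :: "('a \<Rightarrow> complex) \<Rightarrow> 'a \<Rightarrow> ('a \<Rightarrow> 'a) \<Rightarrow> complex"
  where "along_orbit Q x = (\<lambda>\<gamma>. if \<gamma> \<in> G then Q (\<gamma> x) else 0)"

lemma cont_along_orbit:
  assumes "continuous_on UNIV Q"
  shows "cont (along_orbit Q x)"
proof (rule continuous_map_eq)
  show "cont (\<lambda>\<gamma>. Q (\<gamma> x))" by (rule cont_compose[OF assms cont_orbit])
qed (simp add: along_orbit_def topspace_G)

definition orbit_mean :: "('a \<Rightarrow> complex) \<Rightarrow> 'a \<Rightarrow> complex"
  where "orbit_mean Q x = cmean (along_orbit Q x)"

text \<open>Replacing \<open>x\<close> by \<open>\<delta> x\<close> translates the integrand on the
  right by \<open>\<delta>\<close>, and the mean is right invariant.\<close>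

lemma invariant_orbit_mean:
  assumes Q: "continuous_on UNIV Q"
  shows "invariant_function G (orbit_mean Q)"
  unfolding invariant_function_def
proof (intro allI ballI)
  fix x \<delta> assume \<delta>: "\<delta> \<in> G"
  let ?f = "along_orbit Q x"
  let ?g = "\<lambda>\<gamma>. ?f (\<gamma> \<otimes>\<^bsub>composition_monoid G\<^esub> \<delta>)"
  \<comment> \<open>The integrands are compared on \<open>G\<close> only; the estimate with error 0
    turns this into equality of their means.\<close>
  have "norm (cmean (along_orbit Q (\<delta> x)) - cmean ?g) \<le> 0"
    using \<delta> by (intro norm_cmean_diff_le cont_along_orbit Q cont_rmult)
      (simp_all add: carrier_eq along_orbit_def mult_eq comp_in_G)
  moreover have "cmean ?g = cmean ?f"
    using \<delta> by (intro cmean_rmult cont_along_orbit Q) (simp add: carrier_eq)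
  ultimately show "orbit_mean Q (\<delta> x) = orbit_mean Q x" by (simp add: orbit_mean_def)
qed

text \<open>Each orbit is a continuous image of the compact group, hence bounded; uniform
  boundedness then bounds all operators at once.\<close>

lemma equicontinuous:
  obtains M where "M > 0" "\<And>\<gamma> x. \<gamma> \<in> G \<Longrightarrow> norm (\<gamma> x) \<le> M * norm x"
proof (rule uniform_boundedness[of G])
  show "linear \<gamma>" if "\<gamma> \<in> G" for \<gamma>
    using that by (intro clinear_imp_linear clinear_G)
  show "continuous_on UNIV \<gamma>" if "\<gamma> \<in> G" for \<gamma>
    using that action by (simp add: acts_separately_continuously_def)
  show "\<exists>b. \<forall>\<gamma>\<in>G. norm (\<gamma> x) \<le> b" for x
    using cont_bounded[OF cont_orbit, of x] by (metis carrier_eq)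
qed (rule that)

text \<open>\<open>Q\<close> is uniformly continuous near the compact orbit of \<open>x\<close>, and
  the common bound \<open>M\<close> keeps \<open>\<gamma> y\<close> close to
  \<open>\<gamma> x\<close> for all \<open>\<gamma>\<close> simultaneously.\<close>

lemma continuous_orbit_mean:
  assumes Q: "continuous_on UNIV Q"
  shows "continuous_on UNIV (orbit_mean Q)"
  unfolding continuous_on_iff
proof (intro ballI allI impI)
  fix x :: 'a and e :: real assume e: "e > 0"
  obtain M where M: "M > 0" "\<And>\<gamma> x. \<gamma> \<in> G \<Longrightarrow> norm (\<gamma> x) \<le> M * norm x"
    by (rule equicontinuous) (rule that)
  have "compactin euclidean ((\<lambda>\<gamma>. \<gamma> x) ` topspace \<tau>)"
    using compact cont_orbit by (intro image_compactin) (simp_all add: compact_space_def)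
  then have "compact ((\<lambda>\<gamma>. \<gamma> x) ` G)" by (simp add: topspace_G)
  moreover have "e / 2 > 0" using e by simp
  ultimately obtain d where d: "d > 0"
    "\<And>c y. c \<in> (\<lambda>\<gamma>. \<gamma> x) ` G \<Longrightarrow> dist y c < d \<Longrightarrow> dist (Q y) (Q c) < e / 2"
    using Q by (rule_tac compact_uniform_continuity[of _ Q "e / 2"]) auto
  have "dist (orbit_mean Q y) (orbit_mean Q x) < e" if y: "dist y x < d / M" for y
  proof -
    have "norm (orbit_mean Q y - orbit_mean Q x) \<le> e / 2"
      unfolding orbit_mean_def
    proof (intro norm_cmean_diff_le cont_along_orbit Q)
      fix \<gamma> assume "\<gamma> \<in> carrier (composition_monoid G)"
      then have \<gamma>: "\<gamma> \<in> G" by (simp add: carrier_eq)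
      have "dist (\<gamma> y) (\<gamma> x) = norm (\<gamma> (y - x))"
        using clinear_imp_linear[OF clinear_G[OF \<gamma>]] by (simp add: linear_diff dist_norm)
      also have "\<dots> \<le> M * dist y x" using M(2)[OF \<gamma>] by (simp add: dist_norm)
      also have "\<dots> < d" using y M(1) by (simp add: pos_less_divide_eq mult.commute)
      finally have "dist (Q (\<gamma> y)) (Q (\<gamma> x)) < e / 2" using \<gamma> by (intro d(2)) auto
      then show "norm (along_orbit Q y \<gamma> - along_orbit Q x \<gamma>) \<le> e / 2"
        using \<gamma> by (simp add: along_orbit_def dist_norm)
    qed
    with e show ?thesis by (simp add: dist_norm)
  qed
  moreover have "d / M > 0" using d(1) M(1) by simp
  ultimately show "\<exists>d>0. \<forall>y\<in>UNIV. dist y x < d \<longrightarrow> dist (orbit_mean Q y) (orbit_mean Q x) < e"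
    by blast
qed

text \<open>Along an orbit \<open>Q\<close> is continuous, so the mean may be replaced by its linear
  extension \<open>m\<close>, which also accepts the possibly discontinuous forms behind
  \<open>Q\<close>.\<close>

lemma orbit_mean_polynomial:
  assumes "continuous_on UNIV Q"
  shows "polynomial Q \<Longrightarrow> polynomial (orbit_mean Q)"
    and "homogeneous_polynomial k Q \<Longrightarrow> homogeneous_polynomial k (orbit_mean Q)"
proof -
  obtain m :: "(('a \<Rightarrow> 'a) \<Rightarrow> complex) \<Rightarrow> complex"
    where m: "\<And>f g. m (\<lambda>x. f x + g x) = m f + m g" "\<And>c f. m (\<lambda>x. c * f x) = c * m f"
      "\<And>f. cont f \<Longrightarrow> m f = cmean f"
    by (rule cmean_extension) (rule that)
  have eq: "orbit_mean Q = (\<lambda>x. m (\<lambda>\<gamma>. if \<gamma> \<in> G then Q (\<gamma> x) else 0))"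
    using m(3)[OF cont_along_orbit[OF assms]]
    by (simp add: fun_eq_iff orbit_mean_def along_orbit_def)
  show "polynomial Q \<Longrightarrow> polynomial (orbit_mean Q)"
    unfolding eq by (rule polynomial_functional[where T = "\<lambda>\<gamma>. \<gamma>"]) (rule m clinear_G | assumption)+
  show "homogeneous_polynomial k Q \<Longrightarrow> homogeneous_polynomial k (orbit_mean Q)"
    unfolding eq
    by (rule homogeneous_polynomial_functional[where T = "\<lambda>\<gamma>. \<gamma>"]) (rule m clinear_G | assumption)+
qed

lemma orbit_mean_power_separates:
  assumes K: "invariant_set G K" and Q: "continuous_on UNIV Q"
    and sep: "separates Q z K" and z: "1 < cmod (Q z)" and \<eta>: "0 < \<eta>" "\<eta> < 1"
    and fin: "finite {Arg2pi (Q (\<gamma> z)) | \<gamma>. \<gamma> \<in> G \<and> cmod (Q (\<gamma> z)) \<ge> \<eta>}" (is "finite ?A")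
  obtains n where "separates (orbit_mean (\<lambda>x. Q x ^ n)) z K"
proof -
  \<comment> \<open>Separation makes the supremum finite, so it is a real number; it is 0 when
    \<open>K\<close> is empty.\<close>
  define M where "M = enn2real (SUP w\<in>K. ennreal (cmod (Q w)))"
  have "(SUP w\<in>K. ennreal (cmod (Q w))) < Orderings.top"
    using sep unfolding separates_def by (metis ennreal_less_top less_trans)
  then have M: "ennreal M = (SUP w\<in>K. ennreal (cmod (Q w)))"
    unfolding M_def by (rule ennreal_enn2real)
  have M0: "0 \<le> M" by (simp add: M_def)
  have QK: "cmod (Q w) \<le> M" if "w \<in> K" for w
  proof -
    have "ennreal (cmod (Q w)) \<le> ennreal M" unfolding M using that by (rule SUP_upper)
    then show ?thesis using M0 by simp
  qed
  have "M < cmod (Q z)"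
    using sep M0 unfolding separates_def M[symmetric] by (simp add: ennreal_less_iff)
  then obtain r where r: "max M 1 < r" "r < cmod (Q z)"
    using z dense[of "max M 1" "cmod (Q z)"] by auto

  \<comment> \<open>Since \<open>r < cmod (Q z)\<close>, this is an open neighbourhood of the
    identity.\<close>
  define V where "V = {\<gamma> \<in> topspace \<tau>. cmod (Q (\<gamma> z)) \<in> {r<..}}"
  have "cont (\<lambda>\<gamma>. cmod (Q (\<gamma> z)))"
    by (rule cont_compose[OF _ cont_orbit]) (intro continuous_intros Q)
  then have "openin \<tau> V"
    unfolding V_def by (rule openin_continuous_map_preimage) (simp flip: open_openin)
  moreover have "id \<in> V"
    using r one_closed by (simp add: V_def topspace_G carrier_eq one_eq)
  ultimately obtain C where C: "group_list C" "\<And>\<gamma>. \<gamma> \<in> G \<Longrightarrow> \<exists>\<delta>\<in>set C. \<gamma> \<circ> \<delta> \<in> V"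
    using finite_translates_cover[of V] unfolding carrier_eq mult_eq one_eq by blast
  define N where "N = real (length C)"
  have N: "0 < N" using C(1) by (simp add: N_def group_list_def)

  \<comment> \<open>The inequality \<open>Mn\<close> below, divided by \<open>r ^ n\<close>. Both
    ratios are below 1 because \<open>r\<close> exceeds \<open>M\<close> and 1, hence also
    \<open>\<eta>\<close>.\<close>
  have "(\<lambda>n. (M / r) ^ n + 3 / 2 * (\<eta> / r) ^ n) \<longlonglongrightarrow> 0 + 3 / 2 * 0"
    using r M0 \<eta> by (intro tendsto_intros LIMSEQ_power_zero) auto
  then have "\<forall>\<^sub>F n in sequentially. (M / r) ^ n + 3 / 2 * (\<eta> / r) ^ n < 1 / (2 * N)"
    using N by (intro order_tendstoD) auto
  then obtain n0 where n0: "\<And>n. n0 \<le> n \<Longrightarrow> (M / r) ^ n + 3 / 2 * (\<eta> / r) ^ n < 1 / (2 * N)"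
    unfolding eventually_sequentially by blast
  obtain n where n: "n0 \<le> n" "\<And>t. t \<in> ?A \<Longrightarrow> 1 / 2 \<le> cos (real n * t)"
    by (rule simultaneous_cos_ge_half[OF fin]) (rule that)
  have "r ^ n * ((M / r) ^ n + 3 / 2 * (\<eta> / r) ^ n) < r ^ n * (1 / (2 * N))"
    using r n0[OF n(1)] by (intro mult_strict_left_mono) auto
  then have Mn: "M ^ n < 1 / 2 * (r ^ n / N) - 3 / 2 * \<eta> ^ n"
    using r by (simp add: power_divide distrib_left)

  \<comment> \<open>The factor 3/2 covers the values of modulus below \<open>\<eta>\<close>: there
    the real part may be as low as \<open>- cmod (Q (\<gamma> z)) ^ n\<close>, which is 3/2 of that
    power below the main term.\<close>
  have Re_ge: "1 / 2 * cmod (Q (\<gamma> z)) ^ n - 3 / 2 * \<eta> ^ n \<le> Re (Q (\<gamma> z) ^ n)" if \<gamma>: "\<gamma> \<in> G" for \<gamma>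
  proof (cases "\<eta> \<le> cmod (Q (\<gamma> z))")
    case True
    with \<gamma> have "1 / 2 \<le> cos (real n * Arg2pi (Q (\<gamma> z)))" by (intro n(2)) blast
    then have "cmod (Q (\<gamma> z)) ^ n * (1 / 2) \<le> Re (Q (\<gamma> z) ^ n)"
      unfolding Re_power_Arg2pi by (intro mult_left_mono) auto
    moreover have "0 \<le> \<eta> ^ n" using \<eta> by simp
    ultimately show ?thesis by simp
  next
    case False
    then have "cmod (Q (\<gamma> z)) ^ n \<le> \<eta> ^ n" by (intro power_mono) auto
    moreover have "\<bar>Re (Q (\<gamma> z) ^ n)\<bar> \<le> cmod (Q (\<gamma> z)) ^ n"
      using abs_Re_le_cmod[of "Q (\<gamma> z) ^ n"] by (simp add: norm_power)
    ultimately show ?thesis by linarith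
  qed

  define f where "f = (\<lambda>\<gamma>. Re (along_orbit (\<lambda>x. Q x ^ n) z \<gamma>))"
  have Qn: "continuous_on UNIV (\<lambda>x. Q x ^ n)" by (intro continuous_intros Q)
  then have f: "cont f" unfolding f_def by (intro cont_Re cont_along_orbit)
  \<comment> \<open>The bound is proved for the average over \<open>C\<close>, which has the same
    mean as \<open>f\<close>: at each \<open>\<gamma>\<close> some translate falls into
    \<open>V\<close> and contributes at least \<open>r ^ n / N\<close> to the average of the
    moduli.\<close>
  have "1 / 2 * (r ^ n / N) - 3 / 2 * \<eta> ^ n \<le> mean (right_average C f)"
  proof (rule mean_ge)
    show "cont (right_average C f)" using f C(1) by (intro cont_right_average) (auto simp: group_list_def)
    fix \<gamma> assume "\<gamma> \<in> carrier (composition_monoid G)"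
    then have \<gamma>: "\<gamma> \<in> G" by (simp add: carrier_eq)
    let ?q = "\<lambda>\<delta>. cmod (Q (\<gamma> (\<delta> z))) ^ n"
    obtain \<delta> where \<delta>: "\<delta> \<in> set C" "\<gamma> \<circ> \<delta> \<in> V" using C(2)[OF \<gamma>] by blast
    have "r ^ n / N \<le> ?q \<delta> / N"
      using \<delta>(2) r N by (intro divide_right_mono power_mono) (auto simp: V_def)
    also have "\<dots> \<le> average C ?q"
      unfolding N_def using \<delta>(1) by (intro average_ge_member) auto
    finally have "1 / 2 * (r ^ n / N) - 3 / 2 * \<eta> ^ n \<le> 1 / 2 * average C ?q + - (3 / 2 * \<eta> ^ n)"
      by simp
    also have "\<dots> = average C (\<lambda>\<delta>. 1 / 2 * ?q \<delta> + - (3 / 2 * \<eta> ^ n))"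
      using C(1) unfolding average_add average_cmult by (simp add: average_const group_list_def)
    also have "\<dots> \<le> right_average C f \<gamma>"
      unfolding right_average_def
    proof (rule average_mono)
      fix \<delta> assume "\<delta> \<in> set C"
      then have "\<gamma> \<circ> \<delta> \<in> G" using C(1) \<gamma> by (auto simp: group_list_def carrier_eq intro: comp_in_G)
      then show "1 / 2 * ?q \<delta> + - (3 / 2 * \<eta> ^ n) \<le> f (\<gamma> \<otimes>\<^bsub>composition_monoid G\<^esub> \<delta>)"
        using Re_ge[of "\<gamma> \<circ> \<delta>"] by (simp add: f_def along_orbit_def mult_eq)
    qed
    finally show "1 / 2 * (r ^ n / N) - 3 / 2 * \<eta> ^ n \<le> right_average C f \<gamma>" .
  qed
  also have "\<dots> = Re (orbit_mean (\<lambda>x. Q x ^ n) z)"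
    unfolding mean_right_average[OF f C(1)] by (simp add: f_def orbit_mean_def Re_cmean)
  finally have "M ^ n < cmod (orbit_mean (\<lambda>x. Q x ^ n) z)"
    using Mn complex_Re_le_cmod[of "orbit_mean (\<lambda>x. Q x ^ n) z"] by linarith
  then have "ennreal (M ^ n) < ennreal (cmod (orbit_mean (\<lambda>x. Q x ^ n) z))"
    using M0 by (simp add: ennreal_less_iff)
  moreover have "(SUP w\<in>K. ennreal (cmod (orbit_mean (\<lambda>x. Q x ^ n) w))) \<le> ennreal (M ^ n)"
  proof (rule SUP_least)
    fix w assume w: "w \<in> K"
    have "cmod (orbit_mean (\<lambda>x. Q x ^ n) w) \<le> M ^ n"
      unfolding orbit_mean_def
    proof (intro norm_cmean_le cont_along_orbit Qn)
      fix \<gamma> assume "\<gamma> \<in> carrier (composition_monoid G)"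
      then have "\<gamma> \<in> G" by (simp add: carrier_eq)
      with K w have "\<gamma> w \<in> K" by (auto simp: invariant_set_def)
      then have "cmod (Q (\<gamma> w)) ^ n \<le> M ^ n" by (intro power_mono QK) auto
      then show "cmod (along_orbit (\<lambda>x. Q x ^ n) w \<gamma>) \<le> M ^ n"
        using \<open>\<gamma> \<in> G\<close> by (simp add: along_orbit_def norm_power)
    qed
    then show "ennreal (cmod (orbit_mean (\<lambda>x. Q x ^ n) w)) \<le> ennreal (M ^ n)"
      by (rule ennreal_leI)
  qed
  ultimately have "separates (orbit_mean (\<lambda>x. Q x ^ n)) z K"
    unfolding separates_def by (rule le_less_trans[rotated])
  then show ?thesis by (rule that)
qed

end

theorem theorem3p2:
  fixes G :: "('a::complex_banach \<Rightarrow> 'a) set"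
    and \<tau> :: "('a \<Rightarrow> 'a) topology"
    and K :: "'a set" and z :: 'a
    and Q :: "'a \<Rightarrow> complex" and \<eta> :: real
  assumes "compact_operator_group G \<tau>"
    and "acts_separately_continuously G \<tau>"
    and "invariant_set G K"
    and "z \<notin> K"
    and "continuous_polynomial Q"
    and "separates Q z K"
    and "cmod (Q z) > 1"
    and "0 < \<eta>" and "\<eta> < 1"
    and "finite {Arg2pi (Q (\<gamma> z)) | \<gamma>. \<gamma> \<in> G \<and> cmod (Q (\<gamma> z)) \<ge> \<eta>}"
  shows "(\<exists>P. continuous_polynomial P \<and> invariant_function G P \<and> separates P z K) \<and>
         (homogeneous Q \<longrightarrow>
           (\<exists>P. continuous_polynomial P \<and> homogeneous P \<and> invariant_function G P \<and> separates P z K))"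
proof -
  interpret compact_operator_action G \<tau>
    using assms(1,2) by unfold_locales
  have Q: "polynomial Q" "continuous_on UNIV Q"
    using assms(5) by (simp_all add: continuous_polynomial_def)
  obtain n where sep: "separates (orbit_mean (\<lambda>x. Q x ^ n)) z K"
    by (rule orbit_mean_power_separates[OF assms(3) Q(2) assms(6-10)]) (rule that)
  let ?P = "orbit_mean (\<lambda>x. Q x ^ n)"
  have Qn: "continuous_on UNIV (\<lambda>x. Q x ^ n)" by (intro continuous_intros Q)
  have "continuous_polynomial ?P" "invariant_function G ?P"
    unfolding continuous_polynomial_def
    using orbit_mean_polynomial(1)[OF Qn polynomial_power[OF Q(1)]]
      continuous_orbit_mean[OF Qn] invariant_orbit_mean[OF Qn] by simp_all
  moreover have "homogeneous ?P" if "homogeneous Q"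
    using that orbit_mean_polynomial(2)[OF Qn] homogeneous_polynomial_power
    unfolding homogeneous_def by blast
  ultimately show ?thesis using sep by blast
qed

end
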